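(* Let $g$ be a classical simple Lie algebra over $\mathbb C$ with Cartan decomposition $g=\mathbf N^-(g)+\mathbf H(g)+\mathbf N^+(g)$, let $\Lambda$ be its root system, $\Lambda^+$ the corresponding system of positive roots, and let $\lambda_0$ (the initial root) be the highest root. Then $\Lambda^+$ is the union of the root $\lambda_0$, its constituent roots $\{\lambda',\lambda''\mid\lambda'+\lambda''=\lambda_0\}$ and the subsystem $\Lambda^{\bot}_{\lambda_0}$ of positive roots orthogonal to $\lambda_0$: $$\Lambda^+=\{\lambda_0\}\cup\{\lambda'\}\cup\{\lambda''\}\cup\Lambda^{\bot}_{\lambda_0}.$$
   Context: The constituent roots of $\lambda_0$ are the roots belonging to pairs $\lambda',\lambda''\in\Lambda$ with $\lambda'+\lambda''=\lambda_0$ and $\lambda'+\lambda_0,\ \lambda''+\lambda_0\notin\Lambda$; $\{\lambda'\}$ and $\{\lambda''\}$ denote the sets of first and second members of such pairs (one splits the set of constituent roots by choosing one member of each pair as $\lambda'$). $\Lambda^{\bot}_{\lambda_0}=\{\alpha\in\Lambda^+\mid(\alpha,\lambda_0)=0\}$, where $(\cdot,\cdot)$ is the invariant form on the root space. *)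

theory Defs
  imports
    "Jordan_Normal_Form.Matrix"
    "HOL-Library.Function_Algebras"
begin

definition sl_mat :: "nat \<Rightarrow> complex mat set" where
  "sl_mat n = {A \<in> carrier_mat n n. (\<Sum>i<n. A $$ (i, i)) = 0}"

definition so_mat :: "nat \<Rightarrow> complex mat set" where
  "so_mat n = {A \<in> carrier_mat n n. A\<^sup>T = - A}"

definition symp_form :: "nat \<Rightarrow> complex mat" where
  "symp_form n = four_block_mat (0\<^sub>m n n) (1\<^sub>m n) (- 1\<^sub>m n) (0\<^sub>m n n)"

definition sp_mat :: "nat \<Rightarrow> complex mat set" where
  "sp_mat n = {A \<in> carrier_mat (2 * n) (2 * n).
     A\<^sup>T * symp_form n + symp_form n * A = 0\<^sub>m (2 * n) (2 * n)}"

text \<open>The underlying space of the Lie algebra is the whole type \<open>'a\<close>;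
  subspaces and subalgebras are sets.\<close>

locale lie_algebra = vector_space scale
  for scale :: "complex \<Rightarrow> 'a::ab_group_add \<Rightarrow> 'a" (infixr \<open>*\<^sub>L\<close> 75) +
  fixes bracket :: "'a \<Rightarrow> 'a \<Rightarrow> 'a"
  assumes bracket_add_left: "bracket (x + y) z = bracket x z + bracket y z"
    and bracket_add_right: "bracket x (y + z) = bracket x y + bracket x z"
    and bracket_scale_left: "bracket (c *\<^sub>L x) y = c *\<^sub>L bracket x y"
    and bracket_scale_right: "bracket x (c *\<^sub>L y) = c *\<^sub>L bracket x y"
    and bracket_self: "bracket x x = 0"
    and jacobi: "bracket x (bracket y z) + bracket y (bracket z x) + bracket z (bracket x y) = 0"
begin

definition lie_ideal :: "'a set \<Rightarrow> bool" where
  "lie_ideal I \<longleftrightarrow> subspace I \<and> (\<forall>x. \<forall>y\<in>I. bracket x y \<in> I)"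

definition simple_lie :: bool where
  "simple_lie \<longleftrightarrow> (\<exists>x y. bracket x y \<noteq> 0) \<and> (\<forall>I. lie_ideal I \<longrightarrow> I = {0} \<or> I = UNIV)"

definition mat_lie_iso :: "('a \<Rightarrow> complex mat) \<Rightarrow> complex mat set \<Rightarrow> bool" where
  "mat_lie_iso f M \<longleftrightarrow> bij_betw f UNIV M
     \<and> (\<forall>x y. f (x + y) = f x + f y)
     \<and> (\<forall>c x. f (c *\<^sub>L x) = c \<cdot>\<^sub>m f x)
     \<and> (\<forall>x y. f (bracket x y) = f x * f y - f y * f x)"

definition classical_lie :: bool where
  "classical_lie \<longleftrightarrow>
     (\<exists>n f. mat_lie_iso f (sl_mat n) \<or> mat_lie_iso f (so_mat n) \<or> mat_lie_iso f (sp_mat n))"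

text \<open>The trace is taken in an arbitrary basis; it is meaningful in finite dimension only.\<close>

definition lin_trace :: "('a \<Rightarrow> 'a) \<Rightarrow> complex" where
  "lin_trace f = (let B = (SOME B. independent B \<and> span B = UNIV)
     in \<Sum>b\<in>B. representation B (f b) b)"

definition killing :: "'a \<Rightarrow> 'a \<Rightarrow> complex" where
  "killing x y = lin_trace (\<lambda>z. bracket x (bracket y z))"

definition ad_semisimple :: "'a \<Rightarrow> bool" where
  "ad_semisimple h \<longleftrightarrow> span {x. \<exists>c. bracket h x = c *\<^sub>L x} = UNIV"

definition abelian_subalgebra :: "'a set \<Rightarrow> bool" where
  "abelian_subalgebra H \<longleftrightarrow> subspace H \<and> (\<forall>x\<in>H. \<forall>y\<in>H. bracket x y = 0)"

definition cartan_subalgebra :: "'a set \<Rightarrow> bool" where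
  "cartan_subalgebra H \<longleftrightarrow> abelian_subalgebra H
     \<and> (\<forall>K. abelian_subalgebra K \<longrightarrow> H \<subseteq> K \<longrightarrow> K = H)
     \<and> (\<forall>h\<in>H. ad_semisimple h)"

text \<open>A functional on \<open>H\<close> is represented by the function on \<open>'a\<close> that extends it by \<open>0\<close>
  outside \<open>H\<close>, so that equality, sums and negatives of functionals are those of functions.\<close>

definition dual_space :: "'a set \<Rightarrow> ('a \<Rightarrow> complex) set" where
  "dual_space H = {\<alpha>. (\<forall>x\<in>H. \<forall>y\<in>H. \<alpha> (x + y) = \<alpha> x + \<alpha> y)
     \<and> (\<forall>c. \<forall>x\<in>H. \<alpha> (c *\<^sub>L x) = c * \<alpha> x) \<and> (\<forall>x. x \<notin> H \<longrightarrow> \<alpha> x = 0)}"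

definition root_space :: "'a set \<Rightarrow> ('a \<Rightarrow> complex) \<Rightarrow> 'a set" where
  "root_space H \<alpha> = {x. \<forall>h\<in>H. bracket h x = \<alpha> h *\<^sub>L x}"

definition roots :: "'a set \<Rightarrow> ('a \<Rightarrow> complex) set" where
  "roots H = {\<alpha> \<in> dual_space H. \<alpha> \<noteq> 0 \<and> root_space H \<alpha> \<noteq> {0}}"

text \<open>The form on the dual of \<open>H\<close> is transported from the Killing form on \<open>H\<close>:
  \<open>(\<alpha>, \<beta>) = killing t\<^sub>\<alpha> t\<^sub>\<beta>\<close>, where \<open>t\<^sub>\<alpha> \<in> H\<close> represents \<open>\<alpha>\<close>.\<close>

definition dual_vec :: "'a set \<Rightarrow> ('a \<Rightarrow> complex) \<Rightarrow> 'a" where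
  "dual_vec H \<alpha> = (THE t. t \<in> H \<and> (\<forall>h\<in>H. killing t h = \<alpha> h))"

definition root_form :: "'a set \<Rightarrow> ('a \<Rightarrow> complex) \<Rightarrow> ('a \<Rightarrow> complex) \<Rightarrow> complex" where
  "root_form H \<alpha> \<beta> = killing (dual_vec H \<alpha>) (dual_vec H \<beta>)"

definition positive_system :: "'a set \<Rightarrow> ('a \<Rightarrow> complex) set \<Rightarrow> bool" where
  "positive_system H P \<longleftrightarrow> roots H = P \<union> uminus ` P \<and> P \<inter> uminus ` P = {}
     \<and> (\<forall>\<alpha>\<in>P. \<forall>\<beta>\<in>P. \<alpha> + \<beta> \<in> roots H \<longrightarrow> \<alpha> + \<beta> \<in> P)"

definition cartan_decomposition ::
    "'a set \<Rightarrow> 'a set \<Rightarrow> 'a set \<Rightarrow> ('a \<Rightarrow> complex) set \<Rightarrow> bool" where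
  "cartan_decomposition N_minus H N_plus P \<longleftrightarrow>
     cartan_subalgebra H \<and> positive_system H P
     \<and> N_plus = span (\<Union>\<alpha>\<in>P. root_space H \<alpha>)
     \<and> N_minus = span (\<Union>\<alpha>\<in>P. root_space H (- \<alpha>))
     \<and> (\<forall>x. \<exists>!(a, h, b). a \<in> N_minus \<and> h \<in> H \<and> b \<in> N_plus \<and> x = a + h + b)"

text \<open>\<open>\<theta>\<close> is the greatest root in the order in which \<open>\<alpha>\<close> is below \<open>\<beta>\<close> iff \<open>\<beta> - \<alpha>\<close> is a
  (possibly empty) sum of positive roots.\<close>

definition highest_root ::
    "'a set \<Rightarrow> ('a \<Rightarrow> complex) set \<Rightarrow> ('a \<Rightarrow> complex) \<Rightarrow> bool" where
  "highest_root H P \<theta> \<longleftrightarrow> \<theta> \<in> roots H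
     \<and> (\<forall>\<alpha>\<in>roots H. \<exists>\<beta>s. set \<beta>s \<subseteq> P \<and> \<theta> - \<alpha> = sum_list \<beta>s)"

definition constituent_pairs ::
    "'a set \<Rightarrow> ('a \<Rightarrow> complex) \<Rightarrow> (('a \<Rightarrow> complex) \<times> ('a \<Rightarrow> complex)) set" where
  "constituent_pairs H \<theta> = {(\<mu>, \<nu>). \<mu> \<in> roots H \<and> \<nu> \<in> roots H \<and> \<mu> + \<nu> = \<theta>
     \<and> \<mu> + \<theta> \<notin> roots H \<and> \<nu> + \<theta> \<notin> roots H}"

text \<open>The relation \<open>constituent_pairs H \<theta>\<close> is symmetric. A splitting \<open>S\<close> keeps one of the two
  orientations of every pair; \<open>Domain S\<close> and \<open>Range S\<close> are then the sets of first members
  \<open>\<lambda>'\<close> and of second members \<open>\<lambda>''\<close>.\<close>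

definition constituent_splitting ::
    "'a set \<Rightarrow> ('a \<Rightarrow> complex) \<Rightarrow> (('a \<Rightarrow> complex) \<times> ('a \<Rightarrow> complex)) set \<Rightarrow> bool" where
  "constituent_splitting H \<theta> S \<longleftrightarrow> S \<union> S\<inverse> = constituent_pairs H \<theta> \<and> antisym S"

definition orthogonal_roots ::
    "'a set \<Rightarrow> ('a \<Rightarrow> complex) set \<Rightarrow> ('a \<Rightarrow> complex) \<Rightarrow> ('a \<Rightarrow> complex) set" where
  "orthogonal_roots H P \<theta> = {\<alpha> \<in> P. root_form H \<alpha> \<theta> = 0}"

lemma constituent_splitting_exists: "\<exists>S. constituent_splitting H \<theta> S"
proof -
  obtain r :: "(('a \<Rightarrow> complex) \<times> ('a \<Rightarrow> complex)) set" where r: "well_order_on UNIV r"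
    using well_order_on by blast
  have anti: "antisym r" and total: "\<And>a b. (a, b) \<in> r \<or> (b, a) \<in> r"
    using r unfolding well_order_on_def linear_order_on_def partial_order_on_def
      preorder_on_def refl_on_def total_on_def by (blast, metis UNIV_I)
  have "constituent_splitting H \<theta> (constituent_pairs H \<theta> \<inter> r)"
    using anti total unfolding constituent_splitting_def constituent_pairs_def antisym_def
    by (auto simp: add.commute)
  then show ?thesis ..
qed

end

end

theory Submission
  imports Defs
begin

text \<open>
  Choose a basis of common eigenvectors of \<open>H\<close>. If \<open>e\<close> and \<open>f\<close> are root vectors for \<open>\<alpha>\<close> and
  \<open>- \<alpha>\<close>, then \<open>ad [e, f]\<close> has trace \<open>0\<close> on the sum of the weight spaces of a full \<open>\<alpha>\<close>-string,
  which makes \<open>\<beta> [e, f]\<close> a real multiple of \<open>\<alpha> [e, f]\<close> for every weight \<open>\<beta>\<close>. Hence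
  \<open>killing h h\<close> is a sum of squares times \<open>(\<alpha> h)\<^sup>2\<close> for \<open>h = [e, f]\<close>; together with simplicity this
  gives the nondegeneracy of the Killing form and \<open>(\<alpha>, \<alpha>) > 0\<close>. The same trace on the half-string
  below \<open>\<beta>\<close> shows \<open>(\<alpha>, \<beta>) \<ge> 0\<close> as soon as \<open>\<alpha> + \<beta>\<close> is not a weight.

  It follows that no nonempty sum of positive roots vanishes, so \<open>\<theta> + \<alpha>\<close> is never a root for
  positive \<open>\<alpha>\<close>. If \<open>\<theta> - \<alpha>\<close> is not a root either and \<open>\<alpha> \<noteq> \<theta>\<close>, then \<open>(\<alpha>, \<theta>)\<close> is both
  nonnegative and nonpositive; otherwise \<open>\<alpha>\<close> and \<open>\<theta> - \<alpha>\<close> are constituent roots.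
\<close>

text \<open>The sum is \<open>card T\<close> copies of \<open>u\<close> plus the total of the
  \<open>k b\<close> times \<open>v\<close>, so \<open>u\<close> can be solved for. In the string
  arguments \<open>u\<close> and \<open>v\<close> are the values of \<beta> and \<alpha> at [e, f],
  and \<open>k b\<close> is the position of a weight on the string.\<close>

lemma average_multiple:
  fixes k :: "'b \<Rightarrow> real" and u v :: complex
  assumes "finite T" "T \<noteq> {}" and sum0: "(\<Sum>b\<in>T. u + of_real (k b) * v) = 0"
  shows "u = of_real (- (\<Sum>b\<in>T. k b) / card T) * v"
proof -
  have "of_nat (card T) * u + of_real (\<Sum>b\<in>T. k b) * v = 0"
    using sum0 by (simp add: sum.distrib sum_distrib_right)
  moreover have "of_nat (card T) \<noteq> (0::complex)" using assms(1,2) by simp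
  ultimately show ?thesis by (simp add: field_simps add_eq_0_iff)
qed

section \<open>Bracket identities, basis independence of the trace, finite dimension\<close>

context lie_algebra
begin

lemma bracket_zero_left [simp]: "bracket 0 x = 0"
  using bracket_scale_left[of 0 0 x] by simp

lemma bracket_zero_right [simp]: "bracket x 0 = 0"
  using bracket_scale_right[of x 0 0] by simp

lemma bracket_anti: "bracket x y = - bracket y x"
proof -
  have "0 = bracket (x + y) (x + y)" by (simp add: bracket_self)
  also have "\<dots> = bracket x y + bracket y x"
    unfolding bracket_add_left bracket_add_right by (simp add: bracket_self add.commute)
  finally show ?thesis by (metis eq_neg_iff_add_eq_0)
qed

lemma bracket_minus_right: "bracket x (- y) = - bracket x y"
  using bracket_scale_right[of x "-1" y] by simp

lemma bracket_bracket_left: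
  "bracket (bracket x y) z = bracket x (bracket y z) - bracket y (bracket x z)"
proof -
  have "bracket x (bracket y z) - bracket y (bracket x z) - bracket (bracket x y) z = 0"
    using jacobi[of x y z] bracket_anti[of z "bracket x y"] bracket_anti[of z x]
      bracket_minus_right[of y "bracket x z"]
    by simp
  then show ?thesis by simp
qed

lemma bracket_hom: "module_hom scale scale (bracket x)"
  by (simp add: module_hom_iff module_axioms bracket_add_right bracket_scale_right)

lemma bracket_bracket_hom: "module_hom scale scale (\<lambda>z. bracket x (bracket y z))"
  by (simp add: module_hom_iff module_axioms bracket_add_right bracket_scale_right)

text \<open>Both traces expand, through the change of basis coefficients, into the same double sum.
  This allows a trace defined by an arbitrarily chosen basis to be computed in an
  eigenbasis.\<close>

lemma trace_basis_independent:
  assumes B: "independent B" "finite B" "span B = UNIV"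
    and C: "independent C" "finite C" "span C = UNIV"
    and f: "module_hom scale scale f"
  shows "(\<Sum>b\<in>B. representation B (f b) b) = (\<Sum>c\<in>C. representation C (f c) c)"
proof -
  have 1: "representation B (f b) b = (\<Sum>c\<in>C. representation C (f b) c * representation B c b)" for b
  proof -
    have "representation B (f b) b
      = representation B (\<Sum>c\<in>C. scale (representation C (f b) c) c) b"
      using C by (subst sum_representation_eq) auto
    also have "\<dots> = (\<Sum>c\<in>C. representation C (f b) c * representation B c b)"
      using B by (subst representation_sum) (auto simp: representation_scale)
    finally show ?thesis .
  qed
  have 2: "representation C (f c) c = (\<Sum>b\<in>B. representation C (f b) c * representation B c b)" for c
  proof -
    have "f c = f (\<Sum>b\<in>B. scale (representation B c b) b)"
      using B by (subst sum_representation_eq) auto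
    also have "\<dots> = (\<Sum>b\<in>B. scale (representation B c b) (f b))"
      by (simp add: module_hom.sum[OF f] module_hom.scale[OF f])
    finally have "representation C (f c) c
      = representation C (\<Sum>b\<in>B. scale (representation B c b) (f b)) c" by simp
    also have "\<dots> = (\<Sum>b\<in>B. representation C (f b) c * representation B c b)"
      using C by (subst representation_sum) (auto simp: representation_scale mult.commute)
    finally show ?thesis .
  qed
  show ?thesis
    unfolding 1 2 by (rule sum.swap)
qed

text \<open>Reading off entries embeds the space linearly into functions on index pairs, where
  finitely many indicator functions span the image.\<close>

lemma finite_independent_of_mat_embedding:
  fixes f :: "'a \<Rightarrow> complex mat"
  assumes inj: "inj f" and carrier: "\<And>x. f x \<in> carrier_mat n n"
    and add: "\<And>x y. f (x + y) = f x + f y" and smult: "\<And>c x. f (scale c x) = c \<cdot>\<^sub>m f x"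
    and B: "independent B"
  shows "finite B"
proof -
  define fscale :: "complex \<Rightarrow> (nat \<times> nat \<Rightarrow> complex) \<Rightarrow> nat \<times> nat \<Rightarrow> complex"
    where "fscale c g = (\<lambda>p. c * g p)" for c g
  interpret F: vector_space fscale
    by unfold_locales (auto simp: fscale_def fun_eq_iff algebra_simps)
  interpret vector_space_pair scale fscale ..
  define I where "I = {..<n} \<times> {..<n}"
  \<comment> \<open>Entries outside the matrix are replaced by 0: their values are unspecified,
    which would spoil linearity and the finite span.\<close>
  define \<phi> where "\<phi> x = (\<lambda>p. if p \<in> I then f x $$ p else 0)" for x
  have dim: "dim_row (f x) = n" "dim_col (f x) = n" for x using carrier[of x] by auto
  have lin: "Vector_Spaces.linear scale fscale \<phi>"
    unfolding Vector_Spaces.linear_iff using vector_space_axioms F.vector_space_axioms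
    by (auto simp: \<phi>_def fscale_def fun_eq_iff add smult I_def dim)
  have "inj \<phi>"
  proof (rule injI)
    fix x y assume eq: "\<phi> x = \<phi> y"
    have "f x = f y"
    proof (rule eq_matI)
      fix i j assume "i < dim_row (f y)" "j < dim_col (f y)"
      then show "f x $$ (i, j) = f y $$ (i, j)"
        using fun_cong[OF eq, of "(i, j)"] by (simp add: \<phi>_def I_def dim)
    qed (simp_all add: dim)
    then show "x = y" using inj by (simp add: inj_eq)
  qed
  define D where "D = (\<lambda>p q. if q = p then 1 else 0 :: complex) ` I"
  have fin: "finite D" by (simp add: D_def I_def)
  have "\<phi> x \<in> F.span D" for x
  proof -
    have sum_apply: "(\<Sum>p\<in>J. u p) q = (\<Sum>p\<in>J. u p q)" if "finite J"
      for u :: "nat \<times> nat \<Rightarrow> nat \<times> nat \<Rightarrow> complex" and J q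
      using that by (induction J) auto
    have "finite I" by (simp add: I_def)
    then have "\<phi> x = (\<Sum>p\<in>I. fscale (\<phi> x p) (\<lambda>q. if q = p then 1 else 0))"
      by (auto simp: fun_eq_iff sum_apply fscale_def if_distrib \<phi>_def cong: if_cong)
    also have "\<dots> \<in> F.span D"
      by (intro F.span_sum F.span_scale F.span_base) (auto simp: D_def)
    finally show ?thesis .
  qed
  moreover have "F.independent (\<phi> ` B)"
    using linear_independent_injective_image[OF lin B] \<open>inj \<phi>\<close> inj_on_subset by blast
  ultimately have "finite (\<phi> ` B)"
    using F.independent_span_bound[OF fin] by blast
  then show ?thesis using \<open>inj \<phi>\<close> by (metis finite_image_iff inj_on_subset subset_UNIV)
qed

lemma classical_lie_finite_independent:
  assumes "classical_lie" and "independent B"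
  shows "finite B"
proof -
  obtain m f M where iso: "mat_lie_iso f M" and M: "M \<subseteq> carrier_mat m m"
    using assms(1) unfolding classical_lie_def sl_mat_def so_mat_def sp_mat_def by blast
  show ?thesis
  proof (rule finite_independent_of_mat_embedding[of f m B])
    show "f x \<in> carrier_mat m m" for x
      using iso M unfolding mat_lie_iso_def bij_betw_def by blast
  qed (use iso assms(2) in \<open>auto simp: mat_lie_iso_def bij_betw_def\<close>)
qed

end

section \<open>The Killing form in a basis of common eigenvectors of \<open>H\<close>\<close>

locale weight_basis = lie_algebra +
  fixes H :: "'a set" and B :: "'a set" and wt :: "'a \<Rightarrow> 'a \<Rightarrow> complex"
  assumes indep: "independent B" and fin_indep: "\<And>C. independent C \<Longrightarrow> finite C"
    and span_B: "span B = UNIV"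
    and abelian: "abelian_subalgebra H"
    and centralizer: "\<And>x. (\<And>h. h \<in> H \<Longrightarrow> bracket h x = 0) \<Longrightarrow> x \<in> H"
    and wt_dual: "\<And>b. b \<in> B \<Longrightarrow> wt b \<in> dual_space H"
    and wt_space: "\<And>b. b \<in> B \<Longrightarrow> b \<in> root_space H (wt b)"
begin

lemma fin: "finite B" using fin_indep indep by blast

abbreviation rep where "rep \<equiv> representation B"

lemma rep_eq: "(\<Sum>b\<in>B. scale (rep x b) b) = x"
  using indep fin span_B by (intro sum_representation_eq) auto

lemma rep_add: "rep (x + y) b = rep x b + rep y b"
  using indep span_B by (simp add: representation_add)

lemma rep_scale: "rep (scale c x) b = c * rep x b"
  using indep span_B by (simp add: representation_scale)

lemma rep_diff: "rep (x - y) b = rep x b - rep y b"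
  using indep span_B by (simp add: representation_diff)

lemma rep_basis: "b \<in> B \<Longrightarrow> rep b c = (if c = b then 1 else 0)"
  using indep by (simp add: representation_basis)

lemma rep_sum: "rep (\<Sum>i\<in>I. v i) b = (\<Sum>i\<in>I. rep (v i) b)"
  using indep span_B by (simp add: representation_sum)

lemma rep_hom: "module_hom scale scale f \<Longrightarrow> rep (f x) b = (\<Sum>c\<in>B. rep x c * rep (f c) b)"
proof -
  assume f: "module_hom scale scale f"
  have "f x = f (\<Sum>c\<in>B. scale (rep x c) c)" by (simp add: rep_eq)
  also have "\<dots> = (\<Sum>c\<in>B. scale (rep x c) (f c))"
    by (simp add: module_hom.sum[OF f] module_hom.scale[OF f])
  finally show ?thesis by (simp add: rep_sum rep_scale)
qed

lemma basis_ext: "(\<And>b. b \<in> B \<Longrightarrow> rep x b = rep y b) \<Longrightarrow> x = y"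
  using rep_eq[of x] rep_eq[of y] by (metis (no_types, lifting) sum.cong)

lemma basis_nonzero: "b \<in> B \<Longrightarrow> b \<noteq> 0"
  using indep dependent_zero by blast

definition tr :: "('a \<Rightarrow> 'a) \<Rightarrow> complex" where
  "tr f = (\<Sum>b\<in>B. rep (f b) b)"

text \<open>The basis chosen inside \<open>lin_trace\<close> is unknown; its finiteness comes from
  \<open>fin_indep\<close>, which covers every independent set.\<close>

lemma lin_trace_eq: "module_hom scale scale f \<Longrightarrow> lin_trace f = tr f"
proof -
  assume f: "module_hom scale scale f"
  define C where "C = (SOME B. independent B \<and> span B = UNIV)"
  have "independent C \<and> span C = UNIV"
    unfolding C_def using indep span_B by (intro someI) auto
  then show ?thesis
    unfolding lin_trace_def tr_def C_def[symmetric] Let_def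
    using trace_basis_independent fin_indep indep span_B f by blast
qed

lemma killing_eq: "killing x y = tr (\<lambda>z. bracket x (bracket y z))"
  unfolding killing_def by (rule lin_trace_eq[OF bracket_bracket_hom])

lemma tr_comp_commute:
  assumes "module_hom scale scale f" "module_hom scale scale g"
  shows "tr (\<lambda>z. f (g z)) = tr (\<lambda>z. g (f z))"
  unfolding tr_def rep_hom[OF assms(1), of "g _"] rep_hom[OF assms(2), of "f _"]
  by (subst sum.swap) (simp add: mult.commute)

lemma tr_diff: "tr (\<lambda>z. f z - g z) = tr f - tr g"
  by (simp add: tr_def rep_diff sum_subtractf)

lemma killing_commute: "killing x y = killing y x"
  unfolding killing_eq by (rule tr_comp_commute[OF bracket_hom bracket_hom])

lemma killing_add_left: "killing (x + y) z = killing x z + killing y z"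
  unfolding killing_eq by (simp add: tr_def bracket_add_left rep_add sum.distrib)

lemma killing_scale_left: "killing (scale c x) z = c * killing x z"
  unfolding killing_eq by (simp add: tr_def bracket_scale_left rep_scale sum_distrib_left)

lemma killing_add_right: "killing z (x + y) = killing z x + killing z y"
  using killing_add_left killing_commute by metis

lemma killing_scale_right: "killing z (scale c x) = c * killing z x"
  using killing_scale_left killing_commute by metis

lemma killing_zero [simp]: "killing 0 x = 0" "killing x 0 = 0"
  using killing_scale_left[of 0 0 x] killing_scale_right[of x 0 0] by simp_all

lemma killing_expand: "killing x y = (\<Sum>b\<in>B. rep y b * killing x b)"
proof -
  have "killing x y = killing x (\<Sum>b\<in>B. scale (rep y b) b)" by (simp add: rep_eq)
  also have "\<dots> = (\<Sum>b\<in>B. rep y b * killing x b)"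
  proof -
    have "killing x (\<Sum>b\<in>A. scale (rep y b) b) = (\<Sum>b\<in>A. rep y b * killing x b)"
      if "finite A" for A
      using that by induction (simp_all add: killing_add_right killing_scale_right)
    then show ?thesis using fin by blast
  qed
  finally show ?thesis .
qed

text \<open>Write ad [x, y] as a commutator. Cyclicity of the trace moves ad y from the front of the
  second term to the back, which leaves ad x composed with ad [y, z].\<close>

lemma killing_invariant: "killing (bracket x y) z = killing x (bracket y z)"
proof -
  have "killing (bracket x y) z
    = tr (\<lambda>w. bracket x (bracket y (bracket z w))) - tr (\<lambda>w. bracket y (bracket x (bracket z w)))"
    unfolding killing_eq bracket_bracket_left by (rule tr_diff)
  also have "tr (\<lambda>w. bracket y (bracket x (bracket z w)))
    = tr (\<lambda>w. bracket x (bracket z (bracket y w)))"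
    by (rule tr_comp_commute[OF bracket_hom bracket_bracket_hom])
  also have "tr (\<lambda>w. bracket x (bracket y (bracket z w))) - \<dots>
    = tr (\<lambda>w. bracket x (bracket y (bracket z w)) - bracket x (bracket z (bracket y w)))"
    by (rule tr_diff[symmetric])
  also have "\<dots> = killing x (bracket y z)"
    unfolding killing_eq bracket_bracket_left
    by (simp add: module_hom.diff[OF bracket_hom])
  finally show ?thesis .
qed

section \<open>Weights and root spaces\<close>

lemma dual_ext:
  assumes "\<mu> \<in> dual_space H" "\<nu> \<in> dual_space H" "\<And>h. h \<in> H \<Longrightarrow> \<mu> h = \<nu> h"
  shows "\<mu> = \<nu>"
  using assms unfolding dual_space_def by (auto simp: fun_eq_iff) metis

lemma dual_add: "\<mu> \<in> dual_space H \<Longrightarrow> \<nu> \<in> dual_space H \<Longrightarrow> \<mu> + \<nu> \<in> dual_space H"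
  by (auto simp: dual_space_def algebra_simps)

lemma dual_uminus: "\<mu> \<in> dual_space H \<Longrightarrow> - \<mu> \<in> dual_space H"
  by (auto simp: dual_space_def)

lemma dual_zero: "0 \<in> dual_space H"
  by (auto simp: dual_space_def)

lemma root_space_bracket:
  assumes x: "x \<in> root_space H \<mu>" and y: "y \<in> root_space H \<nu>"
  shows "bracket x y \<in> root_space H (\<mu> + \<nu>)"
  unfolding root_space_def
proof safe
  fix h assume "h \<in> H"
  then have "bracket h x = scale (\<mu> h) x" "bracket h y = scale (\<nu> h) y"
    using x y by (auto simp: root_space_def)
  then have "bracket h (bracket x y) = scale (\<mu> h) (bracket x y) + scale (\<nu> h) (bracket x y)"
    using bracket_bracket_left[of h x y]
    by (simp add: bracket_scale_left bracket_scale_right algebra_simps)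
  then show "bracket h (bracket x y) = scale ((\<mu> + \<nu>) h) (bracket x y)"
    by (simp add: scale_left_distrib)
qed

lemma root_space_zero: "root_space H 0 = H"
  using abelian centralizer by (auto simp: root_space_def abelian_subalgebra_def)

text \<open>Apply ad h to x and compare coefficients at \<open>b\<close>: the coefficient of x is
  multiplied by \<open>wt b h\<close> on one side and by \<mu> h on the other.\<close>

lemma rep_root_space:
  assumes x: "x \<in> root_space H \<mu>" and \<mu>: "\<mu> \<in> dual_space H" and b: "b \<in> B" and nz: "rep x b \<noteq> 0"
  shows "wt b = \<mu>"
proof (rule dual_ext[OF wt_dual[OF b] \<mu>])
  fix h assume h: "h \<in> H"
  have "rep (bracket h x) b = (\<Sum>c\<in>B. rep x c * rep (bracket h c) b)"
    by (rule rep_hom[OF bracket_hom])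
  also have "\<dots> = (\<Sum>c\<in>B. if c = b then rep x c * wt c h else 0)"
    using wt_space h by (intro sum.cong) (auto simp: root_space_def rep_scale rep_basis)
  also have "\<dots> = rep x b * wt b h" using b fin by simp
  finally show "wt b h = \<mu> h"
    using x h nz by (simp add: root_space_def rep_scale)
qed

lemma weight_in_image:
  assumes "x \<in> root_space H \<mu>" "\<mu> \<in> dual_space H" "x \<noteq> 0"
  shows "\<mu> \<in> wt ` B"
proof -
  obtain b where "b \<in> B" "rep x b \<noteq> 0"
    using basis_ext[of x 0] assms(3) by (metis representation_zero)
  then show ?thesis using rep_root_space assms by blast
qed

lemma zero_mem_root_space [simp]: "0 \<in> root_space H \<mu>"
  by (simp add: root_space_def)

text \<open>Reduces questions about roots to the finitely many weights of basis vectors. The weight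
  0, which belongs to \<open>H\<close>, must be removed.\<close>

lemma roots_eq: "roots H = wt ` B - {0}"
proof (intro equalityI subsetI)
  fix \<alpha> assume "\<alpha> \<in> roots H"
  then obtain x where "x \<in> root_space H \<alpha>" "x \<noteq> 0" "\<alpha> \<in> dual_space H" "\<alpha> \<noteq> 0"
    unfolding roots_def using zero_mem_root_space by blast
  then show "\<alpha> \<in> wt ` B - {0}" using weight_in_image by blast
next
  fix \<alpha> assume "\<alpha> \<in> wt ` B - {0}"
  then show "\<alpha> \<in> roots H"
    unfolding roots_def using wt_dual wt_space basis_nonzero by blast
qed

lemma root_dual: "\<alpha> \<in> roots H \<Longrightarrow> \<alpha> \<in> dual_space H"
  by (simp add: roots_def)

lemma killing_cartan:
  assumes "h \<in> H" "k \<in> H"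
  shows "killing h k = (\<Sum>b\<in>B. wt b h * wt b k)"
  unfolding killing_eq tr_def
proof (rule sum.cong[OF refl])
  fix b assume b: "b \<in> B"
  then have "bracket h b = scale (wt b h) b" "bracket k b = scale (wt b k) b"
    using wt_space assms by (auto simp: root_space_def)
  then show "rep (bracket h (bracket k b)) b = wt b h * wt b k"
    using b by (simp add: bracket_scale_right rep_scale rep_basis)
qed

text \<open>The factors \<open>r b\<close> are real, so their squares cannot cancel: a vanishing
  left side forces \<open>a\<close> or all \<open>r b\<close> to vanish.\<close>

lemma killing_cartan_real_multiples:
  assumes h: "h \<in> H" and r: "\<And>b. b \<in> B \<Longrightarrow> wt b h = of_real (r b) * a"
  shows "killing h h = of_real (\<Sum>b\<in>B. (r b)\<^sup>2) * a\<^sup>2"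
proof -
  have "killing h h = (\<Sum>b\<in>B. of_real ((r b)\<^sup>2) * a\<^sup>2)"
    unfolding killing_cartan[OF h h] by (intro sum.cong) (auto simp: r power2_eq_square)
  then show ?thesis by (simp add: sum_distrib_right)
qed

section \<open>Traces over weight strings\<close>

lemma bracket_opposite_mem:
  assumes "e \<in> root_space H \<alpha>" "f \<in> root_space H (- \<alpha>)"
  shows "bracket e f \<in> H"
  using root_space_bracket[OF assms] by (simp add: root_space_zero)

text \<open>The sum is the trace of the commutator of \<open>ad e\<close> and \<open>ad f\<close> on the subspace spanned
  by the basis vectors whose weight lies in \<open>W\<close>.\<close>

lemma weight_sum_bracket_zero:
  assumes e: "e \<in> root_space H \<alpha>" and f: "f \<in> root_space H (- \<alpha>)" and \<alpha>: "\<alpha> \<in> dual_space H"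
    and W: "\<And>b c. b \<in> B \<Longrightarrow> c \<in> B \<Longrightarrow> wt c = wt b + \<alpha> \<Longrightarrow> wt b \<in> W \<longleftrightarrow> wt c \<in> W"
  shows "(\<Sum>b\<in>{b\<in>B. wt b \<in> W}. wt b (bracket e f)) = 0"
proof -
  let ?S = "{b\<in>B. wt b \<in> W}"
  have finS: "finite ?S" using fin by simp
  have e_wt: "wt c = wt b + \<alpha>" if "b \<in> B" "c \<in> B" "rep (bracket e b) c \<noteq> 0" for b c
    using rep_root_space[OF root_space_bracket[OF e wt_space[OF that(1)]]
        dual_add[OF \<alpha> wt_dual[OF that(1)]] that(2,3)] by (simp add: add.commute)
  have f_wt: "wt b = wt c + \<alpha>" if "b \<in> B" "c \<in> B" "rep (bracket f b) c \<noteq> 0" for b c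
    using rep_root_space[OF root_space_bracket[OF f wt_space[OF that(1)]]
        dual_add[OF dual_uminus[OF \<alpha>] wt_dual[OF that(1)]] that(2,3)] by simp
  \<comment> \<open>All components of [f, b] have weight \<open>wt b\<close> - \<alpha>, which lies
    in \<open>W\<close> because \<open>wt b\<close> does. So the intermediate sum over
    \<open>B\<close> may be restricted to \<open>?S\<close>.\<close>
  have ef: "rep (bracket e (bracket f b)) b
      = (\<Sum>c\<in>?S. rep (bracket f b) c * rep (bracket e c) b)" if b: "b \<in> ?S" for b
    unfolding rep_hom[OF bracket_hom, of e "bracket f b"]
    proof (rule sum.mono_neutral_right[OF fin _ ballI])
    show "?S \<subseteq> B" by blast
  next
    fix c assume c: "c \<in> B - ?S"
    have "rep (bracket f b) c = 0" using f_wt[of b c] W[of c b] b c by blast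
    then show "rep (bracket f b) c * rep (bracket e c) b = 0" by simp
  qed
  have fe: "rep (bracket f (bracket e b)) b
      = (\<Sum>c\<in>?S. rep (bracket e b) c * rep (bracket f c) b)" if b: "b \<in> ?S" for b
    unfolding rep_hom[OF bracket_hom, of f "bracket e b"]
    proof (rule sum.mono_neutral_right[OF fin _ ballI])
    show "?S \<subseteq> B" by blast
  next
    fix c assume c: "c \<in> B - ?S"
    have "rep (bracket e b) c = 0" using e_wt[of b c] W[of b c] b c by blast
    then show "rep (bracket e b) c * rep (bracket f c) b = 0" by simp
  qed
  have "(\<Sum>b\<in>?S. wt b (bracket e f)) = (\<Sum>b\<in>?S. rep (bracket (bracket e f) b) b)"
    using wt_space bracket_opposite_mem[OF e f]
    by (intro sum.cong) (auto simp: root_space_def rep_scale rep_basis)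
  also have "\<dots> = (\<Sum>b\<in>?S. \<Sum>c\<in>?S. rep (bracket f b) c * rep (bracket e c) b)
      - (\<Sum>b\<in>?S. \<Sum>c\<in>?S. rep (bracket e b) c * rep (bracket f c) b)"
    by (simp add: bracket_bracket_left rep_diff sum_subtractf ef fe)
  also have "\<dots> = 0"
    \<comment> \<open>Exchanging the roles of b and c turns the second double sum into the
      first.\<close>
    by (subst (2) sum.swap) (simp add: mult.commute)
  finally show ?thesis .
qed

text \<open>The set \<open>W\<close> is the full string of integer translates of \<beta> by
  \<alpha>, closed under shifts both ways. The vanishing trace makes the average of the weights on
  it 0 at [e, f].\<close>

lemma weight_real_multiple:
  assumes e: "e \<in> root_space H \<alpha>" and f: "f \<in> root_space H (- \<alpha>)" and \<alpha>: "\<alpha> \<in> dual_space H"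
    and \<beta>: "\<beta> \<in> wt ` B"
  shows "\<exists>r::real. \<beta> (bracket e f) = of_real r * \<alpha> (bracket e f)"
proof -
  define W where "W = {\<mu>. \<exists>k::int. \<forall>x. \<mu> x = \<beta> x + of_real (of_int k) * \<alpha> x}"
  let ?S = "{b\<in>B. wt b \<in> W}"
  have "\<beta> \<in> W" by (auto simp: W_def intro: exI[of _ 0])
  then have ne: "?S \<noteq> {}" using \<beta> by auto
  have "\<mu> \<in> W \<longleftrightarrow> \<mu> + \<alpha> \<in> W" for \<mu>
  proof
    assume "\<mu> \<in> W"
    then obtain k :: int where "\<forall>x. \<mu> x = \<beta> x + of_real (of_int k) * \<alpha> x" by (auto simp: W_def)
    then show "\<mu> + \<alpha> \<in> W" by (auto simp: W_def algebra_simps intro!: exI[of _ "k + 1"])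
  next
    assume "\<mu> + \<alpha> \<in> W"
    then obtain k :: int where "\<forall>x. \<mu> x + \<alpha> x = \<beta> x + of_real (of_int k) * \<alpha> x"
      by (auto simp: W_def)
    then have "\<mu> x = \<beta> x + of_real (of_int (k - 1)) * \<alpha> x" for x
      by (simp add: algebra_simps)
    then show "\<mu> \<in> W" unfolding W_def by blast
  qed
  then have 0: "(\<Sum>b\<in>?S. wt b (bracket e f)) = 0"
    by (intro weight_sum_bracket_zero[OF e f \<alpha>]) auto
  have "\<exists>k::real. \<forall>x. wt b x = \<beta> x + of_real k * \<alpha> x" if "b \<in> ?S" for b
    using that unfolding W_def by blast
  then obtain k :: "'a \<Rightarrow> real" where
    k: "\<And>b x. b \<in> ?S \<Longrightarrow> wt b x = \<beta> x + of_real (k b) * \<alpha> x"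
    using bchoice[of ?S "\<lambda>b k. \<forall>x. wt b x = \<beta> x + of_real k * \<alpha> x"] by blast
  have "(\<Sum>b\<in>?S. \<beta> (bracket e f) + of_real (k b) * \<alpha> (bracket e f)) = 0"
    unfolding 0[symmetric] by (rule sum.cong) (simp_all only: k)
  then have "\<beta> (bracket e f) = of_real (- (\<Sum>b\<in>?S. k b) / card ?S) * \<alpha> (bracket e f)"
    using fin by (intro average_multiple[OF _ ne]) simp_all
  then show ?thesis by blast
qed

text \<open>Here \<open>W\<close> is only the half-string downwards from \<beta>. All positions
  relative to \<beta> are then nonpositive, so minus their average is the required factor.\<close>

lemma weight_nonneg_multiple:
  assumes e: "e \<in> root_space H \<alpha>" and f: "f \<in> root_space H (- \<alpha>)" and \<alpha>: "\<alpha> \<in> dual_space H"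
    and \<beta>: "\<beta> \<in> wt ` B" and top: "\<alpha> + \<beta> \<notin> wt ` B"
  shows "\<exists>q::real. q \<ge> 0 \<and> \<beta> (bracket e f) = of_real q * \<alpha> (bracket e f)"
proof -
  define W where "W = {\<mu>. \<exists>k::nat. \<forall>x. \<mu> x = \<beta> x - of_nat k * \<alpha> x}"
  let ?S = "{b\<in>B. wt b \<in> W}"
  have "\<beta> \<in> W" by (auto simp: W_def intro: exI[of _ 0])
  then have ne: "?S \<noteq> {}" using \<beta> by auto
  have W: "wt b \<in> W \<longleftrightarrow> wt c \<in> W" if "b \<in> B" "c \<in> B" and c: "wt c = wt b + \<alpha>" for b c
  proof
    assume "wt b \<in> W"
    then obtain k :: nat where k: "\<forall>x. wt b x = \<beta> x - of_nat k * \<alpha> x" by (auto simp: W_def)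
    show "wt c \<in> W"
    proof (cases k)
      \<comment> \<open>The half-string can be left upwards only from \<beta> itself, and
        \<open>top\<close> says that no basis vector has the weight \<alpha> + \<beta>.\<close>
      case 0
      then have "wt c = \<alpha> + \<beta>" using c k by (auto simp: fun_eq_iff)
      then show ?thesis using top \<open>c \<in> B\<close> by force
    next
      case (Suc m)
      then show ?thesis using c k by (auto simp: W_def algebra_simps intro!: exI[of _ m])
    qed
  next
    assume "wt c \<in> W"
    then obtain k :: nat where "\<forall>x. wt b x + \<alpha> x = \<beta> x - of_nat k * \<alpha> x"
      using c by (auto simp: W_def)
    then have "wt b x = \<beta> x - of_nat (Suc k) * \<alpha> x" for x
      by (simp add: algebra_simps)
    then show "wt b \<in> W" by (auto simp only: W_def)
  qed
  have 0: "(\<Sum>b\<in>?S. wt b (bracket e f)) = 0"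
    by (rule weight_sum_bracket_zero[OF e f \<alpha> W])
  have "\<exists>k::real. k \<le> 0 \<and> (\<forall>x. wt b x = \<beta> x + of_real k * \<alpha> x)" if "b \<in> ?S" for b
  proof -
    obtain m :: nat where "\<forall>x. wt b x = \<beta> x - of_nat m * \<alpha> x" using \<open>b \<in> ?S\<close> by (auto simp: W_def)
    then show ?thesis by (intro exI[of _ "- real m"]) auto
  qed
  then obtain k :: "'a \<Rightarrow> real" where
    k: "\<And>b x. b \<in> ?S \<Longrightarrow> wt b x = \<beta> x + of_real (k b) * \<alpha> x" and neg: "\<And>b. b \<in> ?S \<Longrightarrow> k b \<le> 0"
    using bchoice[of ?S "\<lambda>b k. k \<le> 0 \<and> (\<forall>x. wt b x = \<beta> x + of_real k * \<alpha> x)"] by blast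
  have "(\<Sum>b\<in>?S. \<beta> (bracket e f) + of_real (k b) * \<alpha> (bracket e f)) = 0"
    unfolding 0[symmetric] by (rule sum.cong) (simp_all only: k)
  then have "\<beta> (bracket e f) = of_real (- (\<Sum>b\<in>?S. k b) / card ?S) * \<alpha> (bracket e f)"
    using fin by (intro average_multiple[OF _ ne]) simp_all
  moreover have "- (\<Sum>b\<in>?S. k b) / card ?S \<ge> 0"
    using sum_nonpos[of ?S k] neg by (simp add: divide_nonpos_nonneg)
  ultimately show ?thesis by blast
qed

text \<open>Invariance moves h from x to y; each side is a scalar multiple of the same nonzero value
  \<open>killing x y\<close>.\<close>

lemma killing_weight:
  assumes x: "x \<in> root_space H \<mu>" and y: "y \<in> root_space H \<nu>" and h: "h \<in> H"
    and nz: "killing x y \<noteq> 0"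
  shows "\<nu> h = - \<mu> h"
proof -
  have "killing (bracket x h) y = - \<mu> h * killing x y"
    using x h bracket_anti[of x h] killing_scale_left[of "- \<mu> h" x y] by (simp add: root_space_def)
  moreover have "killing x (bracket h y) = \<nu> h * killing x y"
    using y h by (simp add: root_space_def killing_scale_right)
  ultimately have "\<nu> h * killing x y = - \<mu> h * killing x y" using killing_invariant by simp
  then show ?thesis using nz by (metis mult_right_cancel)
qed

end

section \<open>Simplicity and nondegeneracy of the Killing form\<close>

locale simple_weight_basis = weight_basis +
  assumes simple: simple_lie
begin

lemma lie_ideal_trivial: "lie_ideal I \<Longrightarrow> I = {0} \<or> I = UNIV"
  using simple by (simp add: simple_lie_def)

text \<open>The center is an ideal, and it is not the whole algebra because some bracket is
  nonzero.\<close>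

lemma center_trivial:
  assumes "\<And>x. bracket x z = 0"
  shows "z = 0"
proof -
  have "lie_ideal {z. \<forall>x. bracket x z = 0}"
    by (auto simp: lie_ideal_def subspace_def bracket_add_right bracket_scale_right)
  then have "{z. \<forall>x. bracket x z = 0} = {0}"
    using lie_ideal_trivial simple by (auto simp: simple_lie_def)
  then show ?thesis using assms by blast
qed

text \<open>Such an h kills the whole eigenbasis and is therefore central.\<close>

lemma cartan_zero:
  assumes h: "h \<in> H" and 0: "\<And>b. b \<in> B \<Longrightarrow> wt b h = 0"
  shows "h = 0"
proof (rule center_trivial)
  fix x
  have "bracket h x = 0"
  proof (rule basis_ext)
    have "rep (bracket h b) c = 0" if "b \<in> B" for b c
      using that wt_space[OF that] 0 h by (simp add: root_space_def representation_zero)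
    then show "rep (bracket h x) b = rep 0 b" for b
      by (subst rep_hom[OF bracket_hom]) (simp add: representation_zero)
  qed
  then show "bracket x h = 0" using bracket_anti[of x h] by simp
qed

text \<open>With h = [e, f], every weight at h is a real multiple of \<alpha> h, so
  \<open>killing h h\<close> is a sum of squares times the square of \<alpha> h. Whichever factor is
  0, all weights vanish at h.\<close>

lemma bracket_opposite_zero:
  assumes e: "e \<in> root_space H \<alpha>" and f: "f \<in> root_space H (- \<alpha>)" and \<alpha>: "\<alpha> \<in> wt ` B"
    and k: "killing (bracket e f) (bracket e f) = 0"
  shows "bracket e f = 0"
proof -
  let ?h = "bracket e f"
  have h: "?h \<in> H" by (rule bracket_opposite_mem[OF e f])
  have \<alpha>d: "\<alpha> \<in> dual_space H" using \<alpha> wt_dual by blast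
  obtain r :: "'a \<Rightarrow> real" where r: "\<And>b. b \<in> B \<Longrightarrow> wt b ?h = of_real (r b) * \<alpha> ?h"
    using bchoice[of B "\<lambda>b r. wt b ?h = of_real r * \<alpha> ?h"] weight_real_multiple[OF e f \<alpha>d] by blast
  have "of_real (\<Sum>b\<in>B. (r b)\<^sup>2) * (\<alpha> ?h)\<^sup>2 = 0"
    using k killing_cartan_real_multiples[OF h r] by simp
  then have "\<alpha> ?h = 0 \<or> (\<forall>b\<in>B. r b = 0)"
    using fin by (auto simp: sum_nonneg_eq_0_iff simp flip: of_real_power of_real_sum)
  then have "\<And>b. b \<in> B \<Longrightarrow> wt b ?h = 0" using r by auto
  then show ?thesis using cartan_zero h by blast
qed

text \<open>If the Killing form vanished, the span of the root vectors would be a proper nonzero ideal.\<close>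

lemma killing_nonzero: "\<exists>x y. killing x y \<noteq> 0"
proof (rule ccontr)
  assume "\<not> ?thesis"
  then have k: "\<And>x y. killing x y = 0" by blast
  \<comment> \<open>In coordinates, the span of the basis vectors of nonzero weight.\<close>
  define N where "N = {x. \<forall>b\<in>B. wt b = 0 \<longrightarrow> rep x b = 0}"
  \<comment> \<open>A bracket reaches weight 0 only from opposite weights, and such brackets vanish
    by \<open>bracket_opposite_zero\<close>, the Killing form being 0.\<close>
  have basis: "rep (bracket b c) d = 0" if b: "b \<in> B" and c: "c \<in> B" "wt c \<noteq> 0" and d: "d \<in> B" "wt d = 0"
    for b c d
  proof (rule ccontr)
    assume nz: "rep (bracket b c) d \<noteq> 0"
    have "wt d = wt b + wt c"
      using rep_root_space[OF root_space_bracket[OF wt_space wt_space] dual_add[OF wt_dual wt_dual]]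
        b c d nz by blast
    then have "wt c = - wt b" using d by (metis eq_neg_iff_add_eq_0 add.commute)
    then have "bracket b c = 0"
      using bracket_opposite_zero[OF wt_space[OF b], of c] wt_space[OF c(1)] b k by simp
    then show False using nz by (simp add: representation_zero)
  qed
  have "lie_ideal N"
    unfolding lie_ideal_def
  proof (intro conjI allI ballI)
    show "subspace N"
      by (auto simp: subspace_def N_def rep_add rep_scale representation_zero)
    fix x y assume y: "y \<in> N"
    show "bracket x y \<in> N"
      unfolding N_def
    proof safe
      fix d assume d: "d \<in> B" "wt d = 0"
      have "rep (bracket x c) d = 0" if c: "c \<in> B" "wt c \<noteq> 0" for c
      proof -
        have "rep (bracket x c) d = - rep (bracket c x) d"
          using bracket_anti[of x c] rep_scale[of "-1" "bracket c x" d] by simp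
        also have "rep (bracket c x) d = (\<Sum>b\<in>B. rep x b * rep (bracket c b) d)"
          by (rule rep_hom[OF bracket_hom])
        also have "\<dots> = 0"
        proof (rule sum.neutral, safe)
          fix b assume b: "b \<in> B"
          have "rep (bracket c b) d = - rep (bracket b c) d"
            using bracket_anti[of c b] rep_scale[of "-1" "bracket b c" d] by simp
          then show "rep x b * rep (bracket c b) d = 0" using basis[OF b c d] by simp
        qed
        finally show ?thesis by simp
      qed
      then show "rep (bracket x y) d = 0"
        using y d by (subst rep_hom[OF bracket_hom]) (auto simp: N_def intro!: sum.neutral)
    qed
  qed
  then consider "N = {0}" | "N = UNIV" using lie_ideal_trivial by blast
  then show False
  proof cases
    \<comment> \<open>All weights are then 0, so \<open>H\<close> is the whole algebra, which would
      be abelian.\<close>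
    case 1
    have "b \<in> H" if b: "b \<in> B" for b
    proof -
      have "wt b = 0"
      proof (rule ccontr)
        assume "wt b \<noteq> 0"
        then have "b \<in> N" using b by (auto simp: N_def rep_basis)
        then show False using 1 basis_nonzero[OF b] by blast
      qed
      then show ?thesis using wt_space[OF b] root_space_zero by simp
    qed
    then have "H = UNIV"
      using span_B span_minimal[of B H] abelian by (auto simp: abelian_subalgebra_def)
    then show False using abelian simple by (auto simp: abelian_subalgebra_def simple_lie_def)
  next
    \<comment> \<open>No basis vector has weight 0, so \<open>H\<close> and its dual are zero. No
      weight is left for a basis vector, and the algebra collapses to 0.\<close>
    case 2
    have no_zero: "wt b \<noteq> 0" if b: "b \<in> B" for b
    proof
      assume "wt b = 0"
      moreover have "b \<in> N" using 2 by simp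
      ultimately show False using b by (auto simp: N_def rep_basis)
    qed
    have "h = 0" if "h \<in> H" for h
      using weight_in_image[of h 0] that no_zero dual_zero by (force simp: root_space_zero)
    then have "\<mu> = 0" if "\<mu> \<in> dual_space H" for \<mu>
    proof (intro dual_ext[OF that dual_zero])
      fix h assume h: "h \<in> H"
      then have "h = 0" "scale 0 h = 0" using \<open>\<And>h. h \<in> H \<Longrightarrow> h = 0\<close> by auto
      moreover have "\<mu> (scale 0 h) = 0 * \<mu> h" using that h by (simp only: dual_space_def mem_Collect_eq)
      ultimately show "\<mu> h = 0 h" by simp
    qed
    then have "B = {}" using no_zero wt_dual by blast
    then have "UNIV = {0::'a}" using span_B span_empty by simp
    then show False using simple by (auto simp: simple_lie_def)
  qed
qed

text \<open>The radical is an ideal by invariance, and \<open>killing_nonzero\<close> prevents it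
  from being everything.\<close>

lemma killing_nondegenerate:
  assumes "\<And>y. killing x y = 0"
  shows "x = 0"
proof -
  have "lie_ideal {x. \<forall>y. killing x y = 0}"
    by (auto simp: lie_ideal_def subspace_def killing_add_left killing_scale_left)
       (metis killing_invariant killing_commute)
  then have "{x. \<forall>y. killing x y = 0} = {0}"
    using lie_ideal_trivial killing_nonzero by blast
  then show ?thesis using assms by blast
qed

text \<open>An element of \<open>H\<close> has weight 0, so it pairs to 0 with basis vectors of
  nonzero weight; those of weight 0 lie in \<open>H\<close>. Orthogonality to \<open>H\<close> thus
  extends to the whole algebra.\<close>

lemma killing_cartan_nondegenerate:
  assumes t: "t \<in> H" and 0: "\<And>h. h \<in> H \<Longrightarrow> killing t h = 0"
  shows "t = 0"
proof (rule killing_nondegenerate)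
  fix y
  have "killing t b = 0" if b: "b \<in> B" for b
  proof (rule ccontr)
    assume nz: "killing t b \<noteq> 0"
    have "t \<in> root_space H 0" using t root_space_zero by simp
    then have "wt b h = 0" if "h \<in> H" for h
      using killing_weight[OF _ wt_space[OF b] that nz] by force
    then have "wt b = 0" by (intro dual_ext[OF wt_dual[OF b] dual_zero]) simp
    then have "b \<in> H" using wt_space[OF b] root_space_zero by simp
    then show False using nz 0 by blast
  qed
  then show "killing t y = 0" by (subst killing_expand) simp
qed

section \<open>Dual vectors of roots and the sign of the form\<close>

lemma dual_vec_bracket:
  assumes \<alpha>: "\<alpha> \<in> roots H"
  obtains e f where "e \<in> root_space H \<alpha>" "f \<in> root_space H (- \<alpha>)" "dual_vec H \<alpha> = bracket e f"
    "\<And>h. h \<in> H \<Longrightarrow> killing (dual_vec H \<alpha>) h = \<alpha> h"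
proof -
  have \<alpha>d: "\<alpha> \<in> dual_space H" using \<alpha> root_dual by blast
  obtain e where e: "e \<in> B" "wt e = \<alpha>" using \<alpha> roots_eq by auto
  then have e\<alpha>: "e \<in> root_space H \<alpha>" using wt_space by blast
  \<comment> \<open>Nondegeneracy gives a basis vector that pairs with \<open>e\<close>;
    \<open>killing_weight\<close> then forces its weight to be -\<alpha>.\<close>
  obtain b where b: "b \<in> B" "killing e b \<noteq> 0"
  proof -
    obtain y where "killing e y \<noteq> 0" using killing_nondegenerate basis_nonzero e by blast
    then have "\<exists>b\<in>B. killing e b \<noteq> 0" 
      using killing_expand[of e y] sum.neutral[of B "\<lambda>b. rep y b * killing e b"] by fastforce
    then show thesis using that by blast
  qed
  \<comment> \<open>Normalised so that \<open>killing e f\<close> is 1; by invariance [e, f] then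
    represents \<alpha> exactly, with no scalar factor.\<close>
  define f where "f = scale (1 / killing e b) b"
  have ef: "killing e f = 1" using b by (simp add: f_def killing_scale_right)
  have "wt b = - \<alpha>"
    using killing_weight[OF e\<alpha> wt_space[OF b(1)] _ b(2)]
    by (intro dual_ext[OF wt_dual[OF b(1)] dual_uminus[OF \<alpha>d]]) simp
  then have f: "f \<in> root_space H (- \<alpha>)"
    using wt_space[OF b(1)] by (auto simp: f_def root_space_def bracket_scale_right mult.commute)
  have h: "bracket e f \<in> H" by (rule bracket_opposite_mem[OF e\<alpha> f])
  have kill: "killing (bracket e f) h = \<alpha> h" if "h \<in> H" for h
  proof -
    have "bracket f h = scale (\<alpha> h) f"
      using bracket_anti[of f h] f that by (simp add: root_space_def)
    then show ?thesis by (simp add: killing_invariant killing_scale_right ef)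
  qed
  have "dual_vec H \<alpha> = bracket e f"
    unfolding dual_vec_def
  proof (rule the_equality)
    fix t assume t: "t \<in> H \<and> (\<forall>h\<in>H. killing t h = \<alpha> h)"
    have H: "subspace H" using abelian by (simp add: abelian_subalgebra_def)
    have "t + scale (-1) (bracket e f) = 0"
    proof (rule killing_cartan_nondegenerate)
      show "t + scale (-1) (bracket e f) \<in> H"
        using t h H by (intro subspace_add subspace_scale) auto
      show "killing (t + scale (-1) (bracket e f)) k = 0" if "k \<in> H" for k
        using t kill that by (simp only: killing_add_left killing_scale_left) simp
    qed
    then show "t = bracket e f" by simp
  qed (use h kill in blast)
  then show thesis using that e\<alpha> f kill by simp
qed

lemma dual_vec_mem: "\<alpha> \<in> roots H \<Longrightarrow> dual_vec H \<alpha> \<in> H"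
  using dual_vec_bracket bracket_opposite_mem by metis

lemma root_form_eq:
  assumes "\<alpha> \<in> roots H" "\<beta> \<in> roots H"
  shows "root_form H \<alpha> \<beta> = \<beta> (dual_vec H \<alpha>)"
  unfolding root_form_def using assms dual_vec_mem dual_vec_bracket[of \<beta>] killing_commute by metis

text \<open>For the dual vector t, \<open>killing t t\<close> is both \<alpha> t and
  \<open>R\<close> times the square of \<alpha> t, with \<open>R\<close> a sum of real squares.
  Cancelling gives \<alpha> t = 1 / \<open>R\<close>.\<close>

lemma root_norm_positive:
  assumes \<alpha>: "\<alpha> \<in> roots H"
  obtains r :: real where "r > 0" "\<alpha> (dual_vec H \<alpha>) = of_real r"
proof -
  obtain e f where e: "e \<in> root_space H \<alpha>" and f: "f \<in> root_space H (- \<alpha>)"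
    and t: "dual_vec H \<alpha> = bracket e f" and kill: "\<And>h. h \<in> H \<Longrightarrow> killing (dual_vec H \<alpha>) h = \<alpha> h"
    using dual_vec_bracket[OF \<alpha>] by metis
  let ?t = "dual_vec H \<alpha>"
  have mem: "?t \<in> H" using dual_vec_mem \<alpha> by blast
  have \<alpha>d: "\<alpha> \<in> dual_space H" using \<alpha> root_dual by blast
  have \<alpha>B: "\<alpha> \<in> wt ` B" using \<alpha> roots_eq by blast
  \<comment> \<open>Otherwise t is isotropic, hence 0 as a bracket of opposite root vectors, and
    \<alpha> would be 0.\<close>
  have nz: "\<alpha> ?t \<noteq> 0"
  proof
    assume "\<alpha> ?t = 0"
    then have "?t = 0" using bracket_opposite_zero[OF e f \<alpha>B] kill[OF mem] t by simp
    then have "\<alpha> = 0" using kill by (intro dual_ext[OF \<alpha>d dual_zero]) auto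
    then show False using \<alpha> roots_eq by simp
  qed
  obtain r :: "'a \<Rightarrow> real" where r: "\<And>b. b \<in> B \<Longrightarrow> wt b ?t = of_real (r b) * \<alpha> ?t"
    using bchoice[of B "\<lambda>b r. wt b ?t = of_real r * \<alpha> ?t"] weight_real_multiple[OF e f \<alpha>d]
    unfolding t by blast
  define R where "R = (\<Sum>b\<in>B. (r b)\<^sup>2)"
  have "\<alpha> ?t = of_real R * (\<alpha> ?t)\<^sup>2"
    using kill[OF mem] killing_cartan_real_multiples[OF mem r] by (simp add: R_def)
  then have "of_real R * \<alpha> ?t = 1" using nz by (simp add: power2_eq_square)
  then have "R \<noteq> 0" and "\<alpha> ?t = of_real (1 / R)"
    by (auto simp: of_real_divide eq_divide_eq mult.commute)
  moreover have "R \<ge> 0" by (simp add: R_def sum_nonneg)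
  ultimately show thesis using that[of "1 / R"] by simp
qed

text \<open>The dual vector is some [e, f], so the half-string bound applies, and the value of
  \<alpha> there is positive. The sum \<alpha> + \<beta> must also differ from 0, since 0 can be a
  weight without being a root.\<close>

lemma root_form_nonneg:
  assumes \<alpha>: "\<alpha> \<in> roots H" and \<beta>: "\<beta> \<in> roots H"
    and "\<alpha> + \<beta> \<notin> roots H" "\<alpha> + \<beta> \<noteq> 0"
  obtains q :: real where "q \<ge> 0" "\<beta> (dual_vec H \<alpha>) = of_real q"
proof -
  obtain e f where e: "e \<in> root_space H \<alpha>" and f: "f \<in> root_space H (- \<alpha>)"
    and t: "dual_vec H \<alpha> = bracket e f"
    using dual_vec_bracket[OF \<alpha>] by metis
  obtain r :: real where r: "r > 0" "\<alpha> (dual_vec H \<alpha>) = of_real r" using root_norm_positive[OF \<alpha>] .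
  have "\<alpha> + \<beta> \<notin> wt ` B" "\<beta> \<in> wt ` B" using assms roots_eq by auto
  then obtain q :: real where "q \<ge> 0" "\<beta> (dual_vec H \<alpha>) = of_real q * \<alpha> (dual_vec H \<alpha>)"
    using weight_nonneg_multiple[OF e f root_dual[OF \<alpha>]] t by metis
  then show thesis using that[of "q * r"] r by simp
qed

section \<open>Positive systems and the highest root\<close>

lemma sum_list_positive_nonzero:
  assumes P: "positive_system H P" and "set \<beta>s \<subseteq> P" "\<beta>s \<noteq> []"
  shows "sum_list \<beta>s \<noteq> 0"
  using assms(2,3)
proof (induction "length \<beta>s" arbitrary: \<beta>s rule: less_induct)
  case less
  have roots: "\<And>\<beta>. \<beta> \<in> P \<Longrightarrow> \<beta> \<in> roots H"
    and disj: "P \<inter> uminus ` P = {}"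
    and closed: "\<And>\<alpha> \<beta>. \<alpha> \<in> P \<Longrightarrow> \<beta> \<in> P \<Longrightarrow> \<alpha> + \<beta> \<in> roots H \<Longrightarrow> \<alpha> + \<beta> \<in> P"
    using P by (auto simp: positive_system_def)
  obtain \<alpha> \<gamma>s where \<beta>s: "\<beta>s = \<alpha> # \<gamma>s" using less.prems by (cases \<beta>s) auto
  then have \<alpha>: "\<alpha> \<in> P" and \<gamma>s: "set \<gamma>s \<subseteq> P" using less.prems by auto
  let ?t = "dual_vec H \<alpha>"
  show ?case
  proof
    assume 0: "sum_list \<beta>s = 0"
    have eval: "sum_list xs x = (\<Sum>\<gamma>\<leftarrow>xs. \<gamma> x)" for xs :: "('a \<Rightarrow> complex) list" and x
      by (induction xs) auto
    \<comment> \<open>The sum vanishes at the dual vector of \<alpha>, where \<alpha> itself is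
      positive, so another summand must be negative there.\<close>
    have "\<exists>\<gamma>\<in>set \<gamma>s. Re (\<gamma> ?t) < 0"
    proof (rule ccontr)
      assume "\<not> ?thesis"
      then have "\<forall>\<gamma>\<in>set \<gamma>s. 0 \<le> Re (\<gamma> ?t)" by force
      then have "0 \<le> Re (\<Sum>\<gamma>\<leftarrow>\<gamma>s. \<gamma> ?t)" by (induction \<gamma>s) auto
      moreover have "\<alpha> ?t + (\<Sum>\<gamma>\<leftarrow>\<gamma>s. \<gamma> ?t) = 0"
        using fun_cong[OF 0, of ?t] by (simp add: \<beta>s eval)
      moreover obtain r :: real where "r > 0" "\<alpha> ?t = of_real r"
        using root_norm_positive[OF roots[OF \<alpha>]] .
      ultimately show False
        by (metis Re_complex_of_real add_pos_nonneg less_irrefl plus_complex.sel(1) zero_complex.sel(1))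
    qed
    then obtain \<gamma> where \<gamma>: "\<gamma> \<in> set \<gamma>s" "Re (\<gamma> ?t) < 0" by blast
    then have "\<gamma> \<in> P" using \<gamma>s by blast
    have "\<alpha> + \<gamma> \<noteq> 0"
      using disj \<alpha> \<open>\<gamma> \<in> P\<close> by (metis IntI empty_iff eq_neg_iff_add_eq_0 imageI)
    moreover have "\<alpha> + \<gamma> \<in> roots H \<or> \<alpha> + \<gamma> = 0"
      using root_form_nonneg[OF roots[OF \<alpha>] roots[OF \<open>\<gamma> \<in> P\<close>]] \<gamma>(2)
      by (metis Re_complex_of_real not_le)
    ultimately have "\<alpha> + \<gamma> \<in> P" using closed \<alpha> \<open>\<gamma> \<in> P\<close> by blast
    \<comment> \<open>Merging \<alpha> and \<gamma> into the positive root \<alpha> + \<gamma> keeps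
      the sum and shortens the list by one.\<close>
    then have "sum_list ((\<alpha> + \<gamma>) # remove1 \<gamma> \<gamma>s) \<noteq> 0"
      using \<gamma>(1) \<gamma>s set_remove1_subset[of \<gamma> \<gamma>s]
      by (intro less.hyps) (auto simp: \<beta>s length_remove1 dest: length_pos_if_in_set)
    then show False
      using 0 \<gamma>(1) by (simp add: \<beta>s add.assoc sum_list_map_remove1[of \<gamma> \<gamma>s "\<lambda>x. x", simplified])
  qed
qed

lemma positive_roots_decomposition:
  assumes P: "positive_system H P" and top: "highest_root H P \<theta>"
    and S: "constituent_splitting H \<theta> S"
  shows "P = {\<theta>} \<union> Domain S \<union> Range S \<union> orthogonal_roots H P \<theta>"
proof -
  have roots: "roots H = P \<union> uminus ` P" and disj: "P \<inter> uminus ` P = {}"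
    using P by (auto simp: positive_system_def)
  have \<theta>: "\<theta> \<in> roots H"
    and above: "\<And>\<alpha>. \<alpha> \<in> roots H \<Longrightarrow> \<exists>\<beta>s. set \<beta>s \<subseteq> P \<and> \<theta> - \<alpha> = sum_list \<beta>s"
    using top by (auto simp: highest_root_def)
  have neg: "- \<alpha> \<in> roots H" if "\<alpha> \<in> roots H" for \<alpha> using that roots by force
  \<comment> \<open>If \<theta> + \<alpha> were a root, -\<alpha> would be a sum of positive roots;
    prepending \<alpha> gives a nonempty sum equal to 0.\<close>
  have maximal: "\<theta> + \<alpha> \<notin> roots H" if \<alpha>: "\<alpha> \<in> P" for \<alpha>
  proof
    assume "\<theta> + \<alpha> \<in> roots H"
    then obtain \<beta>s where \<beta>s: "set \<beta>s \<subseteq> P" "\<theta> - (\<theta> + \<alpha>) = sum_list \<beta>s" using above by blast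
    then have "sum_list (\<alpha> # \<beta>s) = 0" by (simp flip: \<beta>s(2))
    then show False using sum_list_positive_nonzero[OF P, of "\<alpha> # \<beta>s"] \<alpha> \<beta>s by simp
  qed
  \<comment> \<open>If -\<theta> were positive, then 2 \<theta>, a sum of positive roots because
    \<theta> dominates -\<theta>, would be cancelled by two copies of -\<theta>.\<close>
  have \<theta>P: "\<theta> \<in> P"
  proof (rule ccontr)
    assume "\<theta> \<notin> P"
    then have m: "- \<theta> \<in> P" using \<theta> roots by auto
    obtain \<beta>s where \<beta>s: "set \<beta>s \<subseteq> P" "\<theta> - (- \<theta>) = sum_list \<beta>s" using above neg \<theta> by blast
    then have "sum_list (- \<theta> # - \<theta> # \<beta>s) = 0" by (simp flip: \<beta>s(2))
    then show False using sum_list_positive_nonzero[OF P, of "- \<theta> # - \<theta> # \<beta>s"] m \<beta>s by simp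
  qed
  have DR: "Domain S \<union> Range S = Domain (constituent_pairs H \<theta>)"
    using S unfolding constituent_splitting_def by blast
  \<comment> \<open>If -\<mu> were positive, the root \<nu> = \<theta> - \<mu> would contradict
    \<open>maximal\<close>.\<close>
  have pos: "\<mu> \<in> P" if "(\<mu>, \<nu>) \<in> constituent_pairs H \<theta>" for \<mu> \<nu>
  proof (rule ccontr)
    assume "\<mu> \<notin> P"
    moreover have mem: "\<mu> \<in> roots H" "\<nu> \<in> roots H" "\<mu> + \<nu> = \<theta>"
      using that by (auto simp: constituent_pairs_def)
    ultimately have "- \<mu> \<in> P" using roots by auto
    moreover have "\<theta> + - \<mu> = \<nu>" using mem(3) by auto
    ultimately show False using maximal mem(2) by metis
  qed
  have cover: "\<alpha> \<in> orthogonal_roots H P \<theta>"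
    if \<alpha>: "\<alpha> \<in> P" and ne: "\<alpha> \<noteq> \<theta>" and np: "\<alpha> \<notin> Domain (constituent_pairs H \<theta>)" for \<alpha>
  proof -
    have \<alpha>r: "\<alpha> \<in> roots H" using \<alpha> roots by blast
    have not_root: "\<theta> - \<alpha> \<notin> roots H"
    proof
      assume d: "\<theta> - \<alpha> \<in> roots H"
      have "\<theta> - \<alpha> \<in> P"
      proof (rule ccontr)
        assume "\<theta> - \<alpha> \<notin> P"
        then have "- (\<theta> - \<alpha>) \<in> P" using d roots by fastforce
        then have "\<theta> + (- (\<theta> - \<alpha>)) \<notin> roots H" by (rule maximal)
        then show False using \<alpha>r by simp
      qed
      then have "\<theta> + (\<theta> - \<alpha>) \<notin> roots H" "\<theta> + \<alpha> \<notin> roots H" using maximal \<alpha> by blast+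
      then have "(\<alpha>, \<theta> - \<alpha>) \<in> constituent_pairs H \<theta>"
        using \<alpha>r d by (simp add: constituent_pairs_def add.commute)
      then show False using np by blast
    qed
    let ?t = "dual_vec H \<alpha>"
    have "\<alpha> + \<theta> \<notin> roots H" using maximal[OF \<alpha>] by (simp add: add.commute)
    moreover have "\<alpha> + \<theta> \<noteq> 0"
      using disj \<alpha> \<theta>P by (metis IntI empty_iff eq_neg_iff_add_eq_0 imageI)
    ultimately obtain q :: real where q: "q \<ge> 0" "\<theta> ?t = of_real q"
      using root_form_nonneg[OF \<alpha>r \<theta>] by blast
    \<comment> \<open>The same inequality for -\<theta> in place of \<theta> gives the opposite
      sign, so the value is 0.\<close>
    have "\<alpha> + - \<theta> \<notin> roots H" using neg[of "\<alpha> + - \<theta>"] not_root by auto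
    moreover have "\<alpha> + - \<theta> \<noteq> 0" using ne by (metis add.right_inverse add_right_cancel)
    ultimately obtain q' :: real where q': "q' \<ge> 0" "(- \<theta>) ?t = of_real q'"
      using root_form_nonneg[OF \<alpha>r neg[OF \<theta>]] by blast
    have "of_real (q + q') = (0::complex)" using q(2) q'(2) by (simp flip: q(2) q'(2))
    then have "q + q' = 0" by (simp only: of_real_eq_0_iff)
    then have "\<theta> ?t = 0" using q q' by (simp add: add_nonneg_eq_0_iff)
    then show ?thesis using \<alpha> root_form_eq[OF \<alpha>r \<theta>] by (simp add: orthogonal_roots_def)
  qed
  have "orthogonal_roots H P \<theta> \<subseteq> P" by (auto simp: orthogonal_roots_def)
  then show ?thesis using \<theta>P pos cover DR by blast
qed

end

section \<open>From the Cartan decomposition to a weight basis\<close>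

context lie_algebra
begin

text \<open>Adjoining x to \<open>H\<close> gives an abelian subalgebra \<open>K\<close>, which
  equals \<open>H\<close> by maximality.\<close>

lemma cartan_subalgebra_centralizer:
  assumes H: "cartan_subalgebra H" and x: "\<And>h. h \<in> H \<Longrightarrow> bracket h x = 0"
  shows "x \<in> H"
proof -
  have ab: "abelian_subalgebra H" using H by (simp add: cartan_subalgebra_def)
  have sub: "subspace H" and comm: "\<And>h k. h \<in> H \<Longrightarrow> k \<in> H \<Longrightarrow> bracket h k = 0"
    using ab by (auto simp: abelian_subalgebra_def)
  define K where "K = {h + scale c x |h c. h \<in> H}"
  have "abelian_subalgebra K"
    unfolding abelian_subalgebra_def
  proof
    show "subspace K"
      unfolding subspace_def
    proof (intro conjI ballI allI)
      show "0 \<in> K" unfolding K_def using subspace_0[OF sub]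
        by (auto intro!: exI[of _ 0])
      fix u assume "u \<in> K"
      then obtain h c where u: "u = h + scale c x" "h \<in> H" by (auto simp: K_def)
      show "scale a u \<in> K" for a
        using u subspace_scale[OF sub] unfolding K_def
        by (auto simp: scale_right_distrib intro!: exI[of _ "scale a h"] exI[of _ "a * c"])
      fix v assume "v \<in> K"
      then obtain k d where v: "v = k + scale d x" "k \<in> H" by (auto simp: K_def)
      show "u + v \<in> K"
        using u v subspace_add[OF sub] unfolding K_def
        by (auto simp: scale_left_distrib algebra_simps intro!: exI[of _ "h + k"] exI[of _ "c + d"])
    qed
    have "bracket x h = 0" if "h \<in> H" for h using bracket_anti[of x h] x[OF that] by simp
    then show "\<forall>u\<in>K. \<forall>v\<in>K. bracket u v = 0"
      using comm x by (auto simp: K_def bracket_add_left bracket_add_right bracket_scale_left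
          bracket_scale_right bracket_self)
  qed
  moreover have "H \<subseteq> K" unfolding K_def by (force intro: exI[of _ 0])
  ultimately have "K = H" using H by (simp add: cartan_subalgebra_def)
  moreover have "0 + scale 1 x \<in> K" unfolding K_def using subspace_0[OF sub] by blast
  ultimately show ?thesis by simp
qed

text \<open>The three summands are spanned by vectors of the root spaces and of \<open>H\<close>, so
  a basis can be extracted from these. Finiteness comes from the matrix realization.\<close>

lemma cartan_decomposition_weight_basis:
  assumes classical: "classical_lie" and dec: "cartan_decomposition N_minus H N_plus P"
  obtains B wt where "weight_basis scale bracket H B wt"
proof -
  have H: "cartan_subalgebra H" and P: "roots H = P \<union> uminus ` P"
    and Np: "N_plus = span (\<Union>\<alpha>\<in>P. root_space H \<alpha>)"
    and Nm: "N_minus = span (\<Union>\<alpha>\<in>P. root_space H (- \<alpha>))"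
    and ex: "\<And>x. \<exists>a h b. a \<in> N_minus \<and> h \<in> H \<and> b \<in> N_plus \<and> x = a + h + b"
    using dec unfolding cartan_decomposition_def positive_system_def by (blast, blast, blast, blast, fast)
  have ab: "abelian_subalgebra H" using H by (simp add: cartan_subalgebra_def)
  \<comment> \<open>The index 0 is inserted to capture \<open>H\<close>, since 0 is not a
    root.\<close>
  define V where "V = (\<Union>\<mu>\<in>insert 0 (roots H). root_space H \<mu>)"
  have "H \<subseteq> root_space H 0" using ab by (auto simp: root_space_def abelian_subalgebra_def)
  then have "H \<subseteq> span V" using span_superset[of V] by (auto simp: V_def)
  moreover have "N_plus \<subseteq> span V" "N_minus \<subseteq> span V"
    unfolding Np Nm V_def P by (rule span_mono; auto)+
  ultimately have "x \<in> span V" for x using ex[of x] by (meson span_add subset_iff)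
  then have V: "span V = UNIV" by blast
  obtain B where B: "B \<subseteq> V" "independent B" "V \<subseteq> span B"
    using maximal_independent_subset by metis
  have "span B = UNIV" using B V by (metis span_eq span_superset subset_trans span_minimal subspace_span top.extremum_uniqueI)
  have "\<exists>\<mu>. \<mu> \<in> dual_space H \<and> b \<in> root_space H \<mu>" if "b \<in> B" for b
  proof -
    have "0 \<in> dual_space H" by (auto simp: dual_space_def)
    then show ?thesis using that B(1) by (auto simp: V_def roots_def)
  qed
  then obtain wt where wt: "\<And>b. b \<in> B \<Longrightarrow> wt b \<in> dual_space H \<and> b \<in> root_space H (wt b)" by metis
  have "weight_basis scale bracket H B wt"
    by unfold_locales
       (use B \<open>span B = UNIV\<close> ab wt classical_lie_finite_independent[OF classical]
          cartan_subalgebra_centralizer[OF H] in blast)+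
  then show thesis using that by blast
qed

end

theorem mainTheorem3:
  fixes scale :: "complex \<Rightarrow> 'a::ab_group_add \<Rightarrow> 'a"
    and bracket :: "'a \<Rightarrow> 'a \<Rightarrow> 'a"
    and N_minus H N_plus :: "'a set"
    and P :: "('a \<Rightarrow> complex) set"
    and \<theta> :: "'a \<Rightarrow> complex"
    and S :: "(('a \<Rightarrow> complex) \<times> ('a \<Rightarrow> complex)) set"
  assumes "lie_algebra scale bracket"
    and "lie_algebra.classical_lie scale bracket"
    and "lie_algebra.simple_lie scale bracket"
    and "lie_algebra.cartan_decomposition scale bracket N_minus H N_plus P"
    and "lie_algebra.highest_root scale bracket H P \<theta>"
    and "lie_algebra.constituent_splitting scale bracket H \<theta> S"
  shows "P = {\<theta>} \<union> Domain S \<union> Range S \<union> lie_algebra.orthogonal_roots scale bracket H P \<theta>"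
proof -
  interpret lie_algebra scale bracket by fact
  obtain B wt where "weight_basis scale bracket H B wt"
    using cartan_decomposition_weight_basis assms(2,4) by blast
  then interpret simple_weight_basis scale bracket H B wt
    using assms(3) by (simp add: simple_weight_basis_def simple_weight_basis_axioms_def)
  show ?thesis
    using positive_roots_decomposition assms(4,5,6) by (simp add: cartan_decomposition_def)
qed

end
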